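(* Up to isomorphism, the only rigid algebras in $J^2$ are $\psi_0$, $\psi_4$ and $\psi_5$, where, on a basis $\{e_1,e_2\}$ of $\mathbb{R}^2$, the commutative products are $\psi_0$: $e_1\circ e_1=e_1$, $e_2\circ e_2=e_1$, $e_1\circ e_2=e_2$; $\psi_4$: $e_1\circ e_1=e_1$, $e_2\circ e_2=0$, $e_1\circ e_2=\frac12 e_2$; $\psi_5$: $e_1\circ e_1=e_1$, $e_2\circ e_2=-e_1$, $e_1\circ e_2=e_2$. That is, these three algebras are rigid, and every rigid $\varphi\in J^2$ is isomorphic to one of them.
   Context: $J^n$ is the set of Jordan algebra laws on $\mathbb{R}^n$, i.e. symmetric bilinear maps $\varphi:\mathbb{R}^n\times\mathbb{R}^n\to\mathbb{R}^n$ with $\varphi(\varphi(X,X),\varphi(X,Y))=\varphi(X,\varphi(\varphi(X,X),Y))$ for all $X,Y$. It is identified with a real algebraic subset of the finite-dimensional space of structure constants ($\mathbb{R}^6$ for $n=2$), with the induced Euclidean topology. $GL(n,\mathbb{R})$ acts by $(\varphi,f)\mapsto f^{-1}\circ\varphi\circ(f,f)$; the orbit $\mathcal{O}(\varphi)$ consists of the laws isomorphic to $\varphi$. Rigidity: in Nelson's Internal Set Theory, a perturbation of a standard law $\varphi_0\in J^n$ ($n$ standard) is a law $\varphi\in J^n$ infinitely close to $\varphi_0$, i.e. $\varphi(x,y)$ and $\varphi_0(x,y)$ are infinitely close for all standard $x,y\in\mathbb{R}^n$ (equivalently, the structure constants of $\varphi$ and $\varphi_0$ in the standard basis are infinitely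 close). A standard law $\varphi_0$ is rigid if every perturbation of it is isomorphic to $\varphi_0$. By transfer this is the classical notion, which defines rigidity for all laws: $\varphi_0$ is rigid if and only if $\mathcal{O}(\varphi_0)$ is open in $J^n$. *)

theory Defs
  imports "HOL-Analysis.Analysis"
begin

type_synonym 'n law = "real ^ 'n \<Rightarrow> real ^ 'n \<Rightarrow> real ^ 'n"

definition jordan_laws :: "('n::finite) law set" where
  "jordan_laws = {\<phi>. bilinear \<phi> \<and> (\<forall>x y. \<phi> x y = \<phi> y x) \<and>
     (\<forall>x y. \<phi> (\<phi> x x) (\<phi> x y) = \<phi> x (\<phi> (\<phi> x x) y))}"

definition structure_constants :: "('n::finite) law \<Rightarrow> real ^ 'n ^ 'n ^ 'n" where
  "structure_constants \<phi> = (\<chi> i j k. \<phi> (axis i 1) (axis j 1) $ k)"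

text \<open>
  All constants are recorded, also those with \<open>i > j\<close>. On symmetric laws these are redundant,
  and the image of the symmetric laws is a linear subspace, of dimension 6 for laws on the plane,
  so the topology below is the same as the one induced by the non-redundant coordinates.
\<close>

definition jordan_topology :: "('n::finite) law topology" where
  "jordan_topology = pullback_topology jordan_laws structure_constants euclidean"

definition gl :: "(real ^ 'n \<Rightarrow> real ^ 'n) set" where
  "gl = {f. linear f \<and> bij f}"

definition gl_act :: "('n::finite) law \<Rightarrow> (real ^ 'n \<Rightarrow> real ^ 'n) \<Rightarrow> 'n law" where
  "gl_act \<phi> f = (\<lambda>x y. inv f (\<phi> (f x) (f y)))"

definition orbit :: "('n::finite) law \<Rightarrow> 'n law set" where
  "orbit \<phi> = gl_act \<phi> ` gl"

definition isomorphic_laws :: "('n::finite) law \<Rightarrow> 'n law \<Rightarrow> bool" where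
  "isomorphic_laws \<phi> \<psi> \<longleftrightarrow> (\<exists>f. linear f \<and> bij f \<and> (\<forall>x y. f (\<phi> x y) = \<psi> (f x) (f y)))"

definition rigid :: "('n::finite) law \<Rightarrow> bool" where
  "rigid \<phi> \<longleftrightarrow> \<phi> \<in> jordan_laws \<and> openin jordan_topology (orbit \<phi>)"

abbreviation e1 :: "real ^ 2" where "e1 \<equiv> axis 1 1"
abbreviation e2 :: "real ^ 2" where "e2 \<equiv> axis 2 1"

text \<open>The symmetric bilinear law on the plane with prescribed \<open>e1 * e1\<close>, \<open>e2 * e2\<close> and \<open>e1 * e2\<close>.\<close>

definition comm_law :: "real ^ 2 \<Rightarrow> real ^ 2 \<Rightarrow> real ^ 2 \<Rightarrow> 2 law" where
  "comm_law a b c x y =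
     (x $ 1 * y $ 1) *\<^sub>R a + (x $ 2 * y $ 2) *\<^sub>R b + (x $ 1 * y $ 2 + x $ 2 * y $ 1) *\<^sub>R c"

definition psi0 :: "2 law" where "psi0 = comm_law e1 e1 e2"
definition psi4 :: "2 law" where "psi4 = comm_law e1 0 ((1 / 2) *\<^sub>R e2)"
definition psi5 :: "2 law" where "psi5 = comm_law e1 (- e1) e2"

lemma comm_law_basis:
  "comm_law a b c e1 e1 = a" "comm_law a b c e2 e2 = b"
  "comm_law a b c e1 e2 = c" "comm_law a b c e2 e1 = c"
  by (simp_all add: comm_law_def axis_def)

lemma comm_law_bilinear: "bilinear (comm_law a b c)"
  unfolding bilinear_def comm_law_def
  by (auto intro!: linearI simp: algebra_simps)

lemma comm_law_commute: "comm_law a b c x y = comm_law a b c y x"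
  by (simp add: comm_law_def algebra_simps)

lemma topspace_jordan_topology: "topspace jordan_topology = jordan_laws"
  by (simp add: jordan_topology_def topspace_pullback_topology)

lemma inj_on_structure_constants: "inj_on structure_constants (jordan_laws :: ('n::finite) law set)"
proof (rule inj_onI)
  fix \<phi> \<psi> :: "'n law"
  assume J: "\<phi> \<in> jordan_laws" "\<psi> \<in> jordan_laws"
    and eq: "structure_constants \<phi> = structure_constants \<psi>"
  have bil: "bilinear \<phi>" "bilinear \<psi>"
    using J by (auto simp: jordan_laws_def)
  have basis: "\<phi> (axis i 1) (axis j 1) = \<psi> (axis i 1) (axis j 1)" for i j
    using eq by (simp add: structure_constants_def vec_eq_iff)
  show "\<phi> = \<psi>"
    by (rule bilinear_eq_stdbasis[OF bil]) (auto simp: Basis_vec_def basis)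
qed

lemma mem_orbit_iff: "\<psi> \<in> orbit \<phi> \<longleftrightarrow> isomorphic_laws \<psi> \<phi>"
proof
  assume "\<psi> \<in> orbit \<phi>"
  then obtain f where f: "linear f" "bij f" and h: "\<psi> = gl_act \<phi> f"
    by (auto simp: orbit_def gl_def)
  have "f (\<psi> x y) = \<phi> (f x) (f y)" for x y
    by (simp add: h gl_act_def surj_f_inv_f bij_is_surj[OF f(2)])
  then show "isomorphic_laws \<psi> \<phi>"
    using f by (auto simp: isomorphic_laws_def)
next
  assume "isomorphic_laws \<psi> \<phi>"
  then obtain f where f: "linear f" "bij f" and h: "\<And>x y. f (\<psi> x y) = \<phi> (f x) (f y)"
    by (auto simp: isomorphic_laws_def)
  have "\<psi> = gl_act \<phi> f"
    by (intro ext) (simp add: gl_act_def h[symmetric] inv_f_f bij_is_inj[OF f(2)])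
  then show "\<psi> \<in> orbit \<phi>" using f by (auto simp: orbit_def gl_def)
qed

end

theory Submission
  imports Defs "HOL-Real_Asymp.Real_Asymp"
begin

text \<open>
  The form \<open>(x, y) \<mapsto> tr L(x y)\<close>, where \<open>L(z)\<close> is multiplication by \<open>z\<close>, has a discriminant that an
  isomorphism multiplies by the square of its determinant. The algebra \<open>psi4\<close> is the only
  non-associative Jordan algebra of dimension two, and among all of them \<open>psi0\<close> and \<open>psi5\<close> are
  those with positive and negative discriminant. So the three orbits are cut out by open
  conditions. The remaining four isomorphism classes have discriminant zero, and each lies on a
  curve of associative algebras whose other points have nonzero discriminant.

  For the classification, some \<open>u \<noteq> 0\<close> has its square parallel to itself, because \<open>u \<and> u\<^sup>2\<close> is a
  binary cubic form. Either a multiple of \<open>u\<close> is idempotent, or \<open>u\<^sup>2 = 0\<close> and then there is another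
  idempotent or the algebra is nilpotent. Given an idempotent, its Peirce eigenvalue \<open>0\<close>, \<open>1/2\<close> or
  \<open>1\<close> determines the algebra up to one parameter.
\<close>

section \<open>Isomorphism of laws\<close>

lemma isomorphic_laws_refl: "isomorphic_laws \<phi> \<phi>"
  unfolding isomorphic_laws_def by (rule exI[of _ id]) (simp add: linear_id)

lemma isomorphic_laws_trans:
  assumes "isomorphic_laws \<phi> \<psi>" "isomorphic_laws \<psi> \<omega>"
  shows "isomorphic_laws \<phi> \<omega>"
proof -
  obtain f where f: "linear f" "bij f" "\<And>x y. f (\<phi> x y) = \<psi> (f x) (f y)"
    using assms(1) by (auto simp: isomorphic_laws_def)
  obtain g where g: "linear g" "bij g" "\<And>x y. g (\<psi> x y) = \<omega> (g x) (g y)"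
    using assms(2) by (auto simp: isomorphic_laws_def)
  show ?thesis
    unfolding isomorphic_laws_def
    by (rule exI[of _ "g \<circ> f"]) (simp add: linear_compose f g bij_comp)
qed

lemma isomorphic_laws_sym:
  assumes "isomorphic_laws \<phi> \<psi>"
  shows "isomorphic_laws \<psi> \<phi>"
proof -
  obtain f where f: "linear f" "bij f" "\<And>x y. f (\<phi> x y) = \<psi> (f x) (f y)"
    using assms by (auto simp: isomorphic_laws_def)
  have "linear (inv f)"
    using f(1,2) by (metis bij_is_inj bij_is_surj inj_linear_imp_inv_linear)
  moreover have "inv f (\<psi> x y) = \<phi> (inv f x) (inv f y)" for x y
    by (metis f(2,3) bij_inv_eq_iff)
  ultimately show ?thesis
    unfolding isomorphic_laws_def using f(2) bij_imp_bij_inv by blast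
qed

lemma isomorphic_laws_bilinear:
  assumes "isomorphic_laws \<phi> \<psi>" "bilinear \<phi>"
  shows "bilinear \<psi>"
proof -
  obtain g where g: "linear g" "bij g" "\<And>x y. g (\<psi> x y) = \<phi> (g x) (g y)"
    using isomorphic_laws_sym[OF assms(1)] by (auto simp: isomorphic_laws_def)
  have inj: "g u = g v \<Longrightarrow> u = v" for u v
    using g(2) by (metis bij_is_inj injD)
  show ?thesis
    unfolding bilinear_def
    by (intro conjI allI linearI; rule inj)
      (simp_all add: g(3) linear_add[OF g(1)] linear_cmul[OF g(1)]
          bilinear_ladd[OF assms(2)] bilinear_radd[OF assms(2)]
          bilinear_lmul[OF assms(2)] bilinear_rmul[OF assms(2)])
qed

lemma isomorphic_laws_jordan:
  assumes "isomorphic_laws \<phi> \<psi>" "\<phi> \<in> jordan_laws"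
  shows "\<psi> \<in> jordan_laws"
proof -
  obtain g where g: "linear g" "bij g" "\<And>x y. g (\<psi> x y) = \<phi> (g x) (g y)"
    using isomorphic_laws_sym[OF assms(1)] by (auto simp: isomorphic_laws_def)
  have inj: "g u = g v \<Longrightarrow> u = v" for u v
    using g(2) by (metis bij_is_inj injD)
  have sym: "\<And>x y. \<phi> x y = \<phi> y x"
    and jordan: "\<And>x y. \<phi> (\<phi> x x) (\<phi> x y) = \<phi> x (\<phi> (\<phi> x x) y)"
    using assms(2) unfolding jordan_laws_def by blast+
  have "\<psi> x y = \<psi> y x" "\<psi> (\<psi> x x) (\<psi> x y) = \<psi> x (\<psi> (\<psi> x x) y)" for x y
    by (rule inj, simp only: g(3), rule sym, rule inj, simp only: g(3), rule jordan)
  moreover have "bilinear \<psi>"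
    using assms by (intro isomorphic_laws_bilinear[OF assms(1)]) (simp add: jordan_laws_def)
  ultimately show ?thesis
    unfolding jordan_laws_def by blast
qed

text \<open>Isomorphic laws have the same orbit.\<close>

lemma rigid_isomorphic_laws:
  assumes "isomorphic_laws \<phi> \<psi>" "rigid \<phi>"
  shows "rigid \<psi>"
proof -
  have "\<omega> \<in> orbit \<phi> \<longleftrightarrow> \<omega> \<in> orbit \<psi>" for \<omega>
    unfolding mem_orbit_iff
    using assms(1) isomorphic_laws_trans isomorphic_laws_sym by blast
  then have "orbit \<phi> = orbit \<psi>"
    by blast
  then show ?thesis
    using assms(2) isomorphic_laws_jordan[OF assms(1)] by (simp add: rigid_def)
qed

definition associative_law :: "('n::finite) law \<Rightarrow> bool" where
  "associative_law \<phi> \<longleftrightarrow> (\<forall>x y z. \<phi> (\<phi> x y) z = \<phi> x (\<phi> y z))"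

lemma isomorphic_laws_associative:
  assumes "isomorphic_laws \<phi> \<psi>" "associative_law \<psi>"
  shows "associative_law \<phi>"
proof -
  obtain f where f: "bij f" "\<And>x y. f (\<phi> x y) = \<psi> (f x) (f y)"
    using assms(1) by (auto simp: isomorphic_laws_def)
  have "f (\<phi> (\<phi> x y) z) = f (\<phi> x (\<phi> y z))" for x y z
    using assms(2) by (simp add: f(2) associative_law_def)
  then show ?thesis
    unfolding associative_law_def using f(1) by (metis bij_is_inj injD)
qed

text \<open>Under commutativity and associativity both sides of the Jordan identity are
  \<open>x\<^sup>3 y\<close>.\<close>

lemma associative_comm_law_jordan:
  assumes "associative_law (comm_law a b c)"
  shows "comm_law a b c \<in> jordan_laws"
proof -
  have "comm_law a b c (comm_law a b c x x) (comm_law a b c x y) =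
      comm_law a b c x (comm_law a b c (comm_law a b c x x) y)" for x y
    using assms unfolding associative_law_def by (metis comm_law_commute)
  then show ?thesis
    by (auto simp: jordan_laws_def comm_law_bilinear comm_law_commute)
qed

section \<open>The trace form\<close>

definition law_trace :: "('n::finite) law \<Rightarrow> real ^ 'n \<Rightarrow> real" where
  "law_trace \<phi> x = (\<Sum>i\<in>UNIV. \<phi> x (axis i 1) $ i)"

text \<open>The Gram determinant of the trace form in the standard basis.\<close>

definition trace_disc :: "2 law \<Rightarrow> real" where
  "trace_disc \<phi> = law_trace \<phi> (\<phi> e1 e1) * law_trace \<phi> (\<phi> e2 e2) - (law_trace \<phi> (\<phi> e1 e2))\<^sup>2"

text \<open>\<open>f\<close> conjugates multiplication by \<open>x\<close> into multiplication by
  \<open>f x\<close>, and the trace is invariant under conjugation.\<close>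

lemma law_trace_isomorphic:
  fixes \<phi> \<psi> :: "('n::finite) law"
  assumes "linear f" "bij f" "\<And>x y. f (\<phi> x y) = \<psi> (f x) (f y)" "bilinear \<phi>" "bilinear \<psi>"
  shows "law_trace \<phi> x = law_trace \<psi> (f x)"
proof -
  have tr: "law_trace \<omega> z = trace (matrix (\<omega> z))" for \<omega> :: "'n law" and z
    by (simp add: law_trace_def trace_def matrix_def)
  have lin: "linear (\<phi> x)" "linear (\<psi> (f x))"
    using assms(4,5) by (simp_all add: bilinear_def)
  have inv: "invertible (matrix f)"
    using assms(1,2) by (metis bij_is_inj bij_is_surj invertible_eq_bij matrix_vector_mul(2))
  then obtain B where B: "matrix f ** B = mat 1" "B ** matrix f = mat 1"
    by (auto simp: invertible_def)
  have "f \<circ> \<phi> x = \<psi> (f x) \<circ> f"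
    by (auto simp: assms(3))
  then have "matrix f ** matrix (\<phi> x) = matrix (\<psi> (f x)) ** matrix f"
    using matrix_compose assms(1) lin by metis
  then have "matrix (\<phi> x) = B ** (matrix (\<psi> (f x)) ** matrix f)"
    by (metis B(2) matrix_mul_assoc matrix_mul_lid)
  then have "trace (matrix (\<phi> x)) = trace ((matrix (\<psi> (f x)) ** matrix f) ** B)"
    by (simp only: trace_mul_sym[of B])
  also have "\<dots> = trace (matrix (\<psi> (f x)))"
    by (metis B(1) matrix_mul_assoc matrix_mul_rid)
  finally show ?thesis by (simp add: tr)
qed

lemma vec_2_expand: "x = (x $ 1) *\<^sub>R e1 + (x $ 2) *\<^sub>R e2" for x :: "real ^ 2"
  by (simp add: vec_eq_iff forall_2 axis_def)

lemma law_eq_comm_law: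
  assumes "bilinear \<phi>" "\<And>x y. \<phi> x y = \<phi> y x"
  shows "\<phi> = comm_law (\<phi> e1 e1) (\<phi> e2 e2) (\<phi> e1 e2)"
proof (intro ext)
  fix x y :: "real ^ 2"
  have "\<phi> x y = \<phi> ((x $ 1) *\<^sub>R e1 + (x $ 2) *\<^sub>R e2) ((y $ 1) *\<^sub>R e1 + (y $ 2) *\<^sub>R e2)"
    by (simp flip: vec_2_expand)
  then show "\<phi> x y = comm_law (\<phi> e1 e1) (\<phi> e2 e2) (\<phi> e1 e2) x y"
    by (simp add: comm_law_def bilinear_ladd[OF assms(1)] bilinear_radd[OF assms(1)]
        bilinear_lmul[OF assms(1)] bilinear_rmul[OF assms(1)] assms(2)[of e2 e1] algebra_simps)
qed

text \<open>An isomorphism preserves the trace form, so the Gram matrices are congruent through the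
  matrix of \<open>f\<close>; \<open>d\<close> is its determinant.\<close>

lemma trace_disc_isomorphic:
  assumes "isomorphic_laws \<phi> (comm_law a b c)" "\<phi> \<in> jordan_laws"
  obtains d where "d \<noteq> 0" "trace_disc \<phi> = d\<^sup>2 * trace_disc (comm_law a b c)"
proof -
  let ?\<psi> = "comm_law a b c"
  obtain f where f: "linear f" "bij f" "\<And>x y. f (\<phi> x y) = ?\<psi> (f x) (f y)"
    using assms(1) by (auto simp: isomorphic_laws_def)
  have bil: "bilinear \<phi>"
    using assms(2) by (simp add: jordan_laws_def)
  define u v where "u = f e1" and "v = f e2"
  define d where "d = u $ 1 * v $ 2 - u $ 2 * v $ 1"
  have "invertible (matrix f)"
    using f(1,2) by (metis invertible_eq_bij matrix_vector_mul(2))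
  then have "d \<noteq> 0"
    unfolding invertible_det_nz det_2 d_def u_def v_def by (simp add: matrix_def mult.commute)
  have tr: "law_trace \<phi> (\<phi> x y) = law_trace ?\<psi> (?\<psi> (f x) (f y))" for x y
    using law_trace_isomorphic[OF f bil comm_law_bilinear] by (simp add: f(3))
  define A B C where "A = law_trace ?\<psi> a" and "B = law_trace ?\<psi> b" and "C = law_trace ?\<psi> c"
  have T: "law_trace ?\<psi> (?\<psi> x y) =
      x $ 1 * y $ 1 * A + x $ 2 * y $ 2 * B + (x $ 1 * y $ 2 + x $ 2 * y $ 1) * C" for x y
    by (simp add: A_def B_def C_def law_trace_def sum_2 comm_law_def axis_def algebra_simps)
  have "trace_disc ?\<psi> = A * B - C\<^sup>2"
    by (simp add: trace_disc_def comm_law_basis A_def B_def C_def)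
  moreover have "trace_disc \<phi> = d\<^sup>2 * (A * B - C\<^sup>2)"
    unfolding trace_disc_def tr T u_def[symmetric] v_def[symmetric] d_def by algebra
  ultimately have "trace_disc \<phi> = d\<^sup>2 * trace_disc ?\<psi>"
    by simp
  then show thesis using that \<open>d \<noteq> 0\<close> by blast
qed

section \<open>The topology of the space of laws\<close>

text \<open>A left inverse of \<open>structure_constants\<close> on bilinear laws. It is defined for
  every array, so that continuity can be checked on the whole space of constants.\<close>

definition law_of_constants :: "real ^ 'n ^ 'n ^ 'n \<Rightarrow> ('n::finite) law" where
  "law_of_constants S = (\<lambda>x y. \<chi> k. \<Sum>i\<in>UNIV. \<Sum>j\<in>UNIV. x $ i * y $ j * S $ i $ j $ k)"

lemma law_of_structure_constants:
  assumes "bilinear \<phi>"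
  shows "law_of_constants (structure_constants \<phi>) = \<phi>"
proof (intro ext)
  fix x y :: "real ^ 'a"
  have "\<phi> x y = \<phi> (\<Sum>i\<in>UNIV. x $ i *\<^sub>R axis i 1) (\<Sum>j\<in>UNIV. y $ j *\<^sub>R axis j 1)"
    by (simp add: basis_expansion flip: scalar_mult_eq_scaleR)
  also have "\<dots> = (\<Sum>i\<in>UNIV. \<Sum>j\<in>UNIV. (x $ i * y $ j) *\<^sub>R \<phi> (axis i 1) (axis j 1))"
    using assms
    by (simp add: bilinear_sum bilinear_lmul bilinear_rmul sum.cartesian_product case_prod_unfold)
  finally show "law_of_constants (structure_constants \<phi>) x y = \<phi> x y"
    by (simp add: law_of_constants_def structure_constants_def vec_eq_iff)
qed

lemma continuous_law_of_constants:
  assumes "continuous_on UNIV f" "continuous_on UNIV g"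
  shows "continuous_on UNIV (\<lambda>S. law_of_constants S (f S) (g S))"
  unfolding law_of_constants_def by (intro continuous_intros assms)

lemma openin_jordan_topology:
  "openin jordan_topology A \<longleftrightarrow>
    (\<exists>U. open U \<and> A = {\<phi> \<in> jordan_laws. structure_constants \<phi> \<in> U})"
  by (auto simp: jordan_topology_def openin_pullback_topology)

text \<open>For a fixed triple, failure of associativity is an inequality between continuous
  functions of the constants; \<open>U\<close> is the union of these open sets.\<close>

lemma openin_nonassociative: "openin jordan_topology {\<phi> \<in> jordan_laws. \<not> associative_law \<phi>}"
proof -
  define U :: "(real ^ 'a ^ 'a ^ 'a) set" where
    "U = (\<Union>x y z. {S. law_of_constants S (law_of_constants S x y) z \<noteq>
      law_of_constants S x (law_of_constants S y z)})"
  have "open U"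
    unfolding U_def
    by (intro open_UN ballI open_Collect_neq continuous_law_of_constants continuous_on_const)
  moreover have "structure_constants \<phi> \<in> U \<longleftrightarrow> \<not> associative_law \<phi>" if "\<phi> \<in> jordan_laws" for \<phi>
    using that law_of_structure_constants[of \<phi>]
    by (simp add: U_def associative_law_def jordan_laws_def)
  ultimately show ?thesis
    unfolding openin_jordan_topology by (intro exI[of _ U]) auto
qed

lemma continuous_trace_disc: "continuous_on UNIV (\<lambda>S. trace_disc (law_of_constants S))"
  unfolding trace_disc_def law_trace_def
  by (intro continuous_intros continuous_law_of_constants)

lemma openin_trace_disc:
  assumes "open V"
  shows "openin jordan_topology {\<phi> \<in> jordan_laws. trace_disc \<phi> \<in> V}"
proof -
  let ?U = "(\<lambda>S. trace_disc (law_of_constants S)) -` V"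
  have "open ?U"
    using open_vimage[OF assms continuous_trace_disc] .
  moreover have "trace_disc (law_of_constants (structure_constants \<phi>)) = trace_disc \<phi>"
    if "\<phi> \<in> jordan_laws" for \<phi>
    using that by (simp add: law_of_structure_constants jordan_laws_def)
  ultimately show ?thesis
    unfolding openin_jordan_topology by (intro exI[of _ ?U]) auto
qed

text \<open>The laws near a rigid law are isomorphic to it, so a zero of the discriminant persists.\<close>

lemma not_rigid_if_deformation:
  fixes a b c :: "real \<Rightarrow> real ^ 2"
  assumes "continuous_on UNIV a" "continuous_on UNIV b" "continuous_on UNIV c"
    and jordan: "\<And>t. comm_law (a t) (b t) (c t) \<in> jordan_laws"
    and zero: "trace_disc (comm_law (a 0) (b 0) (c 0)) = 0"
    and nonzero: "\<And>t. t \<noteq> 0 \<Longrightarrow> trace_disc (comm_law (a t) (b t) (c t)) \<noteq> 0"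
  shows "\<not> rigid (comm_law (a 0) (b 0) (c 0))"
proof
  let ?N = "\<lambda>t. comm_law (a t) (b t) (c t)"
  assume "rigid (?N 0)"
  then obtain U where "open U"
    and U: "orbit (?N 0) = {\<phi> \<in> jordan_laws. structure_constants \<phi> \<in> U}"
    by (auto simp: rigid_def openin_jordan_topology)
  have "continuous_on UNIV (\<lambda>t. structure_constants (?N t))"
    unfolding structure_constants_def comm_law_def by (intro continuous_intros assms)
  then have "open ((\<lambda>t. structure_constants (?N t)) -` U)"
    using open_vimage \<open>open U\<close> by blast
  moreover have "0 \<in> (\<lambda>t. structure_constants (?N t)) -` U"
    using U isomorphic_laws_refl[of "?N 0"] by (auto simp: mem_orbit_iff[symmetric])
  ultimately have "\<exists>\<epsilon>>0. \<forall>t. dist t 0 < \<epsilon> \<longrightarrow> t \<in> (\<lambda>t. structure_constants (?N t)) -` U"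
    unfolding open_dist by blast
  then obtain \<epsilon> where "\<epsilon> > 0" and \<epsilon>: "\<And>t. dist t 0 < \<epsilon> \<Longrightarrow> structure_constants (?N t) \<in> U"
    by auto
  define t where "t = \<epsilon> / 2"
  have "?N t \<in> orbit (?N 0)"
    unfolding U using \<epsilon>[of t] jordan \<open>\<epsilon> > 0\<close> by (simp add: t_def)
  then obtain d where "trace_disc (?N t) = d\<^sup>2 * trace_disc (?N 0)"
    using trace_disc_isomorphic[OF _ jordan] unfolding mem_orbit_iff by metis
  then show False
    using zero nonzero[of t] \<open>\<epsilon> > 0\<close> by (simp add: t_def)
qed

section \<open>Classification of the Jordan laws on the plane\<close>

text \<open>The last three hypotheses are the multiplication table of \<open>\<phi>\<close> in the
  basis \<open>u\<close>, \<open>v\<close>. Every explicit change of basis below goes through this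
  lemma.\<close>

lemma isomorphic_comm_law_basis:
  fixes u v :: "real ^ 2"
  assumes "bilinear \<phi>" "\<And>x y. \<phi> x y = \<phi> y x"
    and det: "u $ 1 * v $ 2 - u $ 2 * v $ 1 \<noteq> 0"
    and "\<phi> u u = (a $ 1) *\<^sub>R u + (a $ 2) *\<^sub>R v"
    and "\<phi> v v = (b $ 1) *\<^sub>R u + (b $ 2) *\<^sub>R v"
    and "\<phi> u v = (c $ 1) *\<^sub>R u + (c $ 2) *\<^sub>R v"
  shows "isomorphic_laws \<phi> (comm_law a b c)"
proof -
  define g where "g x = (x $ 1) *\<^sub>R u + (x $ 2) *\<^sub>R v" for x :: "real ^ 2"
  have lin: "linear g"
    unfolding g_def by (intro linearI) (simp_all add: algebra_simps)
  have "det (matrix g) = u $ 1 * v $ 2 - u $ 2 * v $ 1"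
    by (simp add: det_2 matrix_def g_def axis_def mult.commute)
  then have "invertible (matrix g)"
    using det by (simp add: invertible_det_nz)
  then have "bij g"
    using lin by (metis invertible_eq_bij matrix_vector_mul(2))
  moreover have "g (comm_law a b c x y) = \<phi> (g x) (g y)" for x y
    by (simp add: g_def comm_law_def bilinear_ladd[OF assms(1)] bilinear_radd[OF assms(1)]
        bilinear_lmul[OF assms(1)] bilinear_rmul[OF assms(1)] assms(2)[of v u] assms(4-6)
        algebra_simps)
  ultimately have "isomorphic_laws (comm_law a b c) \<phi>"
    using lin by (auto simp: isomorphic_laws_def)
  then show ?thesis
    by (rule isomorphic_laws_sym)
qed

lemma isomorphic_comm_law_eigenvector:
  fixes u :: "real ^ 2"
  assumes "bilinear \<phi>" "\<And>x y. \<phi> x y = \<phi> y x" "u \<noteq> 0" "\<phi> u u = k *\<^sub>R u"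
  shows "\<exists>b c. isomorphic_laws \<phi> (comm_law (k *\<^sub>R e1) b c)"
proof -
  \<comment> \<open>\<open>v\<close> is \<open>u\<close> turned by a right angle, so the determinant
    of the pair is the squared length \<open>D\<close> of \<open>u\<close>.\<close>
  define v where "v = (- u $ 2) *\<^sub>R e1 + (u $ 1) *\<^sub>R e2"
  have v: "v $ 1 = - u $ 2" "v $ 2 = u $ 1"
    by (simp_all add: v_def axis_def)
  have "u $ 1 \<noteq> 0 \<or> u $ 2 \<noteq> 0"
    using assms(3) by (auto simp: vec_eq_iff forall_2)
  define D where "D = (u $ 1)\<^sup>2 + (u $ 2)\<^sup>2"
  then have nz: "D \<noteq> 0"
    using \<open>u $ 1 \<noteq> 0 \<or> u $ 2 \<noteq> 0\<close> by (simp add: sum_power2_eq_zero_iff)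
  have "\<exists>p :: real ^ 2. w = (p $ 1) *\<^sub>R u + (p $ 2) *\<^sub>R v" for w :: "real ^ 2"
  proof
    \<comment> \<open>As \<open>u\<close> and \<open>v\<close> are orthogonal of the same length,
      the coordinates of \<open>w\<close> are its inner products with them, divided by
      \<open>D\<close>.\<close>
    let ?p = "(1 / D) *\<^sub>R
      (vector [u $ 1 * w $ 1 + u $ 2 * w $ 2, u $ 1 * w $ 2 - u $ 2 * w $ 1] :: real ^ 2)"
    have "w $ 1 = (u $ 1 * (u $ 1 * w $ 1 + u $ 2 * w $ 2) - u $ 2 * (u $ 1 * w $ 2 - u $ 2 * w $ 1)) / D"
      "w $ 2 = (u $ 2 * (u $ 1 * w $ 1 + u $ 2 * w $ 2) + u $ 1 * (u $ 1 * w $ 2 - u $ 2 * w $ 1)) / D"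
      unfolding nonzero_eq_divide_eq[OF nz] by (simp_all add: D_def power2_eq_square algebra_simps)
    then show "w = (?p $ 1) *\<^sub>R u + (?p $ 2) *\<^sub>R v"
      by (simp add: vec_eq_iff forall_2 v add_divide_distrib diff_divide_distrib algebra_simps)
  qed
  then obtain b c :: "real ^ 2" where "\<phi> v v = (b $ 1) *\<^sub>R u + (b $ 2) *\<^sub>R v"
      "\<phi> u v = (c $ 1) *\<^sub>R u + (c $ 2) *\<^sub>R v"
    by metis
  then have "isomorphic_laws \<phi> (comm_law (k *\<^sub>R e1) b c)"
    using nz assms
    by (intro isomorphic_comm_law_basis[of _ u v]) (simp_all add: v D_def power2_eq_square axis_def)
  then show ?thesis by blast
qed

lemma monic_cubic_root:
  fixes p q r :: real
  obtains s where "s ^ 3 + p * s\<^sup>2 + q * s + r = 0"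
proof -
  let ?g = "\<lambda>s. s ^ 3 + p * s\<^sup>2 + q * s + r"
  have "filterlim ?g at_top at_top" "filterlim ?g at_bot at_bot"
    by real_asymp+
  then have "\<forall>\<^sub>F s in at_top. ?g s \<ge> 0" "\<forall>\<^sub>F s in at_bot. ?g s \<le> 0"
    by (simp_all add: filterlim_at_top filterlim_at_bot)
  then obtain M m where M: "\<And>s. s \<ge> M \<Longrightarrow> ?g s \<ge> 0" and m: "\<And>s. s \<le> m \<Longrightarrow> ?g s \<le> 0"
    unfolding eventually_at_top_linorder eventually_at_bot_linorder by blast
  \<comment> \<open>The bounds \<open>m\<close> and \<open>M\<close> come in no known order, hence
    \<open>min\<close> and \<open>max\<close>.\<close>
  have "\<exists>s\<ge>min m M. s \<le> max m M \<and> ?g s = 0"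
    by (intro IVT' continuous_intros) (auto intro: M m)
  then show thesis using that by blast
qed

lemma jordan_identity:
  "\<phi> \<in> jordan_laws \<Longrightarrow> \<phi> (\<phi> x x) (\<phi> x y) = \<phi> x (\<phi> (\<phi> x x) y)"
  unfolding jordan_laws_def by blast

text \<open>On basis vectors this yields polynomial relations between the structure constants, such
  as the Peirce equation of an idempotent.\<close>

lemma jordan_linearized:
  assumes "\<phi> \<in> jordan_laws"
  shows "2 *\<^sub>R \<phi> (\<phi> u v) (\<phi> u y) + \<phi> (\<phi> u u) (\<phi> v y) =
    \<phi> v (\<phi> (\<phi> u u) y) + 2 *\<^sub>R \<phi> u (\<phi> (\<phi> u v) y)"
proof -
  have bil: "bilinear \<phi>"
    and sym: "\<And>x y. \<phi> x y = \<phi> y x"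
    and jordan: "\<And>x. \<phi> (\<phi> x x) (\<phi> x y) - \<phi> x (\<phi> (\<phi> x x) y) = 0"
    using assms unfolding jordan_laws_def by auto
  \<comment> \<open>On vectors \<open>2 * z\<close> is a componentwise product; rewritten as a
    scalar multiple it is open to the bilinearity rules.\<close>
  have two: "2 * z = 2 *\<^sub>R z" for z :: "real ^ 'a"
    by (simp only: scaleR_2 mult_2)
  note expand = two bilinear_ladd[OF bil] bilinear_radd[OF bil] bilinear_lsub[OF bil]
    bilinear_rsub[OF bil] bilinear_lmul[OF bil] bilinear_rmul[OF bil] sym[of v u]
  \<comment> \<open>The part of the Jordan identity linear in \<open>v\<close>: its even parts in \<open>v\<close> cancel between \<open>u + v\<close>
    and \<open>u - v\<close>, and the cubic part is the identity at \<open>v\<close>.\<close>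
  have "2 *\<^sub>R (2 *\<^sub>R \<phi> (\<phi> u v) (\<phi> u y) + \<phi> (\<phi> u u) (\<phi> v y) -
      (\<phi> v (\<phi> (\<phi> u u) y) + 2 *\<^sub>R \<phi> u (\<phi> (\<phi> u v) y))) =
    (\<phi> (\<phi> (u + v) (u + v)) (\<phi> (u + v) y) - \<phi> (u + v) (\<phi> (\<phi> (u + v) (u + v)) y))
    - (\<phi> (\<phi> (u - v) (u - v)) (\<phi> (u - v) y) - \<phi> (u - v) (\<phi> (\<phi> (u - v) (u - v)) y))
    - 2 *\<^sub>R (\<phi> (\<phi> v v) (\<phi> v y) - \<phi> v (\<phi> (\<phi> v v) y))"
    by (simp add: expand vec_eq_iff algebra_simps)
  also have "\<dots> = 0"
    by (simp only: jordan) simp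
  finally show ?thesis by simp
qed

text \<open>With unit \<open>e1\<close>, the algebra is a quotient of the real polynomial ring by a
  quadratic: two copies of the reals (\<open>psi0\<close>), the complex numbers
  (\<open>psi5\<close>) or the dual numbers.\<close>

lemma unital_comm_law_cases:
  "isomorphic_laws (comm_law e1 b e2) psi0 \<or> isomorphic_laws (comm_law e1 b e2) psi5 \<or>
    isomorphic_laws (comm_law e1 b e2) (comm_law e1 0 e2)"
proof -
  define d where "d = b $ 1 + (b $ 2)\<^sup>2 / 4"
  \<comment> \<open>Dividing by \<open>r\<close> normalizes \<open>d\<close> to 1 or -1; for
    \<open>d = 0\<close> any positive value serves.\<close>
  define r where "r = (if d = 0 then 1 else sqrt \<bar>d\<bar>)"
  have "r > 0" and r2: "d \<noteq> 0 \<Longrightarrow> r\<^sup>2 = \<bar>d\<bar>"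
    by (auto simp: r_def)
  \<comment> \<open>Completing the square makes the square of \<open>?v\<close> a multiple of the unit.\<close>
  let ?v = "(1 / r) *\<^sub>R (e2 - (b $ 2 / 2) *\<^sub>R e1)"
  have iso: "isomorphic_laws (comm_law e1 b e2) (comm_law e1 ((d / r\<^sup>2) *\<^sub>R e1) e2)"
    using \<open>r > 0\<close>
    by (intro isomorphic_comm_law_basis[of _ e1 ?v] comm_law_bilinear comm_law_commute)
      (simp_all add: comm_law_def axis_def vec_eq_iff forall_2 d_def power2_eq_square field_simps)
  consider "d = 0" | "d / r\<^sup>2 = 1" | "d / r\<^sup>2 = - 1"
    using r2 \<open>r > 0\<close> by (cases "d > 0"; cases "d = 0") (auto simp: field_simps)
  then show ?thesis
    using iso by cases (auto simp: psi0_def psi5_def)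
qed

text \<open>Multiplication by \<open>e1\<close> is triangular with eigenvalues 1 and
  \<open>l\<close>. On \<open>e2\<close> the linearized identity makes it a root of
  \<open>2 X^3 - 3 X^2 + X\<close>, which leaves the three Peirce eigenvalues for
  \<open>l\<close>.\<close>

lemma jordan_idempotent_cases:
  assumes J: "comm_law e1 b c \<in> jordan_laws"
  shows "\<exists>N \<in> {psi0, psi4, psi5, comm_law e1 0 0, comm_law e1 0 e2}.
    isomorphic_laws (comm_law e1 b c) N"
proof -
  note simps = comm_law_def axis_def vec_eq_iff forall_2
  define m l where "m = c $ 1" and "l = c $ 2"
  note E = jordan_linearized[OF J, of e1 e2 e1]
  have "l * ((2 * l - 1) * (l - 1)) = 0" and ml: "m * (l * (1 - 2 * l)) = 0"
    using E by (simp_all add: simps m_def l_def algebra_simps)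
  then consider "l = 0" | "l = 1 / 2" | "l = 1"
    by auto
  then show ?thesis
  proof cases
    case 3
    \<comment> \<open>For \<open>l = 1\<close> the relation \<open>ml\<close> gives
      \<open>m = 0\<close>: the repeated eigenvalue has no Jordan block, and \<open>e1\<close> is a
      unit.\<close>
    then have "c = e2"
      using ml by (simp add: m_def l_def axis_def vec_eq_iff forall_2)
    then show ?thesis
      using unital_comm_law_cases[of b] by auto
  next
    case 1
    \<comment> \<open>\<open>e2 + s *\<^sub>R e1\<close> is an eigenvector of multiplication by \<open>e1\<close>.\<close>
    define s q where "s = - m" and "q = b $ 2"
    \<comment> \<open>The square of the new vector in the new basis;
      \<open>2 * s * m + s\<^sup>2\<close> has become \<open>m * s\<close> because
      \<open>s = - m\<close>.\<close>
    let ?B = "vector [b $ 1 + m * s - q * s, q] :: real ^ 2"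
    have iso: "isomorphic_laws (comm_law e1 b c) (comm_law e1 ?B 0)"
      using \<open>l = 0\<close>
      by (intro isomorphic_comm_law_basis[of _ e1 "e2 + s *\<^sub>R e1"] comm_law_bilinear comm_law_commute)
        (simp_all add: simps s_def q_def m_def l_def algebra_simps)
    \<comment> \<open>In the new law \<open>e1\<close> kills \<open>e2\<close>, and the identity
      says that it also kills the square of \<open>e2\<close>.\<close>
    have "?B $ 1 = 0"
      using jordan_linearized[OF isomorphic_laws_jordan[OF iso J], of e1 e2 e2]
      by (simp add: simps)
    then have B: "?B = q *\<^sub>R e2"
      by (simp add: vec_eq_iff forall_2 axis_def)
    show ?thesis
    proof (cases "q = 0")
      case True
      then show ?thesis using iso B by auto
    next
      case False
      \<comment> \<open>\<open>(1 / q) *\<^sub>R e2\<close> is an idempotent orthogonal to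
        \<open>e1\<close>. The sum of the two is the unit, and their difference squares to
        it.\<close>
      then have "isomorphic_laws (comm_law e1 (q *\<^sub>R e2) 0) (comm_law e1 e1 e2)"
        by (intro isomorphic_comm_law_basis[of _ "e1 + (1 / q) *\<^sub>R e2" "e1 - (1 / q) *\<^sub>R e2"]
            comm_law_bilinear comm_law_commute) (simp_all add: simps)
      then show ?thesis
        using isomorphic_laws_trans iso B by (auto simp: psi0_def)
    qed
  next
    case 2
    \<comment> \<open>\<open>s\<close> makes \<open>e2 + s *\<^sub>R e1\<close> an eigenvector of
      multiplication by \<open>e1\<close> for the eigenvalue 1/2; \<open>?B\<close> again holds the
      coordinates of its square.\<close>
    define s q where "s = - 2 * m" and "q = b $ 2 + s"
    let ?B = "vector [b $ 1 + 2 * s * m + s\<^sup>2 - q * s, q] :: real ^ 2"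
    have iso: "isomorphic_laws (comm_law e1 b c) (comm_law e1 ?B ((1 / 2) *\<^sub>R e2))"
      using \<open>l = 1 / 2\<close>
      by (intro isomorphic_comm_law_basis[of _ e1 "e2 + s *\<^sub>R e1"] comm_law_bilinear comm_law_commute)
        (simp_all add: simps s_def q_def m_def l_def power2_eq_square algebra_simps)
    note J' = isomorphic_laws_jordan[OF iso J]
    \<comment> \<open>The identity says that multiplying the square of \<open>e2\<close> by
      \<open>e1\<close> twice is the same as once, so this square has no part of eigenvalue
      1/2.\<close>
    have "?B $ 2 = 0"
      using jordan_linearized[OF J', of e2 e1 e1] by (simp add: simps)
    \<comment> \<open>If \<open>e2\<close> squares to \<open>t *\<^sub>R e1\<close>, the two sides
      of the identity are \<open>t / 4\<close> and \<open>t / 2\<close> times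
      \<open>e2\<close>.\<close>
    moreover have "?B $ 1 = 0"
      using jordan_identity[OF J', of e2 e1] \<open>?B $ 2 = 0\<close> by (simp add: simps algebra_simps)
    ultimately have "?B = 0"
      by (simp add: vec_eq_iff forall_2)
    then show ?thesis
      using iso by (auto simp: psi4_def)
  qed
qed

text \<open>For \<open>u = s *\<^sub>R e1 + e2\<close>, being parallel to its square is a cubic
  equation in \<open>s\<close> with leading coefficient \<open>a $ 2\<close>. If that vanishes, the
  point at infinity \<open>e1\<close> is a solution.\<close>

lemma square_parallel_exists:
  fixes a b c :: "real ^ 2"
  obtains u k where "u \<noteq> 0" "comm_law a b c u u = k *\<^sub>R u"
proof (cases "a $ 2 = 0")
  case True
  then have "comm_law a b c e1 e1 = (a $ 1) *\<^sub>R e1"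
    by (simp add: comm_law_def vec_eq_iff forall_2 axis_def)
  then show thesis
    using that[of e1 "a $ 1"] by (simp add: axis_eq_0_iff)
next
  case False
  obtain s where s: "s ^ 3 + ((2 * c $ 2 - a $ 1) / a $ 2) * s\<^sup>2 + ((b $ 2 - 2 * c $ 1) / a $ 2) * s
      + (- b $ 1 / a $ 2) = 0"
    by (rule monic_cubic_root)
  have "a $ 2 * s ^ 3 + (2 * c $ 2 - a $ 1) * s\<^sup>2 + (b $ 2 - 2 * c $ 1) * s - b $ 1 =
      a $ 2 * (s ^ 3 + ((2 * c $ 2 - a $ 1) / a $ 2) * s\<^sup>2 + ((b $ 2 - 2 * c $ 1) / a $ 2) * s
      + (- b $ 1 / a $ 2))"
    using False by (simp add: field_simps)
  then have s: "a $ 2 * s ^ 3 + (2 * c $ 2 - a $ 1) * s\<^sup>2 + (b $ 2 - 2 * c $ 1) * s - b $ 1 = 0"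
    using s by simp
  define u where "u = s *\<^sub>R e1 + e2"
  have u: "u $ 1 = s" "u $ 2 = 1"
    by (simp_all add: u_def axis_def)
  have "comm_law a b c u u = (s\<^sup>2 * a $ 2 + b $ 2 + 2 * s * c $ 2) *\<^sub>R u"
    using s by (simp add: vec_eq_iff forall_2 comm_law_def u power2_eq_square power3_eq_cube algebra_simps)
  moreover have "u \<noteq> 0"
    using u(2) by auto
  ultimately show thesis using that by blast
qed

text \<open>Once \<open>c $ 2 = 0\<close> is known, \<open>e1\<close> spans an ideal, and modulo it
  \<open>e2\<close> squares to \<open>q\<close> times itself. For \<open>q\<close> nonzero the
  idempotent of the quotient lifts; for \<open>q = 0\<close> the algebra is nilpotent.\<close>

lemma jordan_square_zero_cases:
  assumes J: "comm_law 0 b c \<in> jordan_laws"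
  shows "(\<exists>w. w \<noteq> 0 \<and> comm_law 0 b c w w = w) \<or>
    isomorphic_laws (comm_law 0 b c) (comm_law 0 0 0) \<or>
    isomorphic_laws (comm_law 0 b c) (comm_law e2 0 0)"
proof -
  note simps = comm_law_def axis_def vec_eq_iff forall_2
  define p q m where "p = b $ 1" and "q = b $ 2" and "m = c $ 1"
  \<comment> \<open>The identity says that multiplying \<open>e2\<close> three times by
    \<open>e1\<close> gives zero, so the eigenvalue \<open>c $ 2\<close> vanishes.\<close>
  have c2: "c $ 2 = 0"
    using jordan_linearized[OF J, of e1 e2 e1] by (auto simp: simps)
  have mq: "m * ((q - m) * (q - 2 * m)) = 0"
    using jordan_linearized[OF J, of e2 e1 e2] c2
    by (simp add: simps p_def q_def m_def algebra_simps)
  show ?thesis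
  proof (cases "q = 0")
    case False
    \<comment> \<open>If \<open>q = 2 * m\<close> then \<open>s\<close> below is the junk value \<open>0 / 0 = 0\<close>, which still works as then \<open>p = 0\<close>.\<close>
    have pm: "p = 0" if "q = 2 * m"
      using jordan_identity[OF J, of e2 e2] c2 that False
      by (simp add: simps p_def q_def m_def algebra_simps)
    define s where "s = p / (q - 2 * m)"
    \<comment> \<open>This is the condition for \<open>e2 + s *\<^sub>R e1\<close> to square to
      \<open>q\<close> times itself.\<close>
    have s: "p + 2 * s * m = q * s"
      using pm by (cases "q = 2 * m") (simp_all add: s_def field_simps)
    let ?v = "e2 + s *\<^sub>R e1"
    let ?w = "(1 / q) *\<^sub>R ?v"
    have "comm_law 0 b c ?v ?v = q *\<^sub>R ?v"
      using s c2 by (simp add: simps p_def q_def m_def algebra_simps)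
    then have "comm_law 0 b c ?w ?w = ?w"
      using False by (simp only: bilinear_lmul[OF comm_law_bilinear] bilinear_rmul[OF comm_law_bilinear]) simp
    moreover have "?w $ 2 \<noteq> 0"
      using False by (simp add: axis_def)
    then have "?w \<noteq> 0" by (metis zero_index)
    ultimately show ?thesis by blast
  next
    case True
    \<comment> \<open>For \<open>q = 0\<close> the relation \<open>mq\<close> reads
      \<open>2 * m ^ 3 = 0\<close>.\<close>
    then have "c = 0"
      using mq c2 by (simp add: m_def vec_eq_iff forall_2)
    have b: "b = p *\<^sub>R e1"
      using True by (simp add: p_def q_def simps)
    show ?thesis
    proof (cases "p = 0")
      case True
      then show ?thesis
        using b \<open>c = 0\<close> by (simp add: isomorphic_laws_refl)
    next
      case False
      then have "isomorphic_laws (comm_law 0 b c) (comm_law e2 0 0)"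
        unfolding b \<open>c = 0\<close>
        by (intro isomorphic_comm_law_basis[of _ e2 "p *\<^sub>R e1"] comm_law_bilinear comm_law_commute)
          (simp_all add: simps)
      then show ?thesis by blast
    qed
  qed
qed

lemma jordan_plane_cases:
  fixes \<phi> :: "2 law"
  assumes J: "\<phi> \<in> jordan_laws"
  shows "\<exists>N \<in> {psi0, psi4, psi5, comm_law e1 0 0, comm_law e1 0 e2, comm_law 0 0 0, comm_law e2 0 0}.
    isomorphic_laws \<phi> N"
proof -
  have bil: "bilinear \<psi>" and sym: "\<psi> x y = \<psi> y x" if "\<psi> \<in> jordan_laws" for \<psi> :: "2 law" and x y
    using that unfolding jordan_laws_def by blast+
  \<comment> \<open>Stated for any law isomorphic to \<open>\<phi>\<close>, since the idempotent may
    be found only after passing to a basis in which \<open>e1\<close> squares to zero.\<close>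
  have idempotent: ?thesis
    if iso: "isomorphic_laws \<phi> \<psi>" and w: "w \<noteq> 0" "\<psi> w w = w" for \<psi> w
  proof -
    note J' = isomorphic_laws_jordan[OF iso J]
    obtain b c where bc: "isomorphic_laws \<psi> (comm_law e1 b c)"
      using isomorphic_comm_law_eigenvector[OF bil[OF J'] sym[OF J'] w(1), of 1] w(2) by auto
    obtain N where "N \<in> {psi0, psi4, psi5, comm_law e1 0 0, comm_law e1 0 e2}"
      "isomorphic_laws (comm_law e1 b c) N"
      using jordan_idempotent_cases isomorphic_laws_jordan[OF bc J'] by blast
    then show ?thesis
      using isomorphic_laws_trans[OF iso isomorphic_laws_trans[OF bc]] by blast
  qed
  obtain u k where u: "u \<noteq> 0" "\<phi> u u = k *\<^sub>R u"
    using square_parallel_exists law_eq_comm_law[OF bil[OF J] sym[OF J]] by metis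
  show ?thesis
  proof (cases "k = 0")
    case False
    have "\<phi> ((1 / k) *\<^sub>R u) ((1 / k) *\<^sub>R u) = (1 / k) *\<^sub>R u"
      using u False by (simp add: bilinear_lmul[OF bil[OF J]] bilinear_rmul[OF bil[OF J]])
    then show ?thesis
      using u False by (intro idempotent[OF isomorphic_laws_refl, of "(1 / k) *\<^sub>R u"]) simp_all
  next
    case True
    then obtain b c where bc: "isomorphic_laws \<phi> (comm_law 0 b c)"
      using isomorphic_comm_law_eigenvector[OF bil[OF J] sym[OF J] u] by auto
    then show ?thesis
      using jordan_square_zero_cases[OF isomorphic_laws_jordan[OF bc J]]
        idempotent[OF bc] isomorphic_laws_trans[OF bc] by blast
  qed
qed

section \<open>Rigidity\<close>

text \<open>At \<open>t = 0\<close> the four families are the degenerate laws. The second is the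
  quotient of the polynomial ring by \<open>X^2 - t\<close>; the last is the ideal generated by
  \<open>X\<close> in the quotient by \<open>X^3 - t^2 X\<close>, with \<open>e1 = X\<close> and
  \<open>e2 = X^2\<close>.\<close>

lemma associative_degenerations:
  "associative_law psi0" "associative_law psi5"
  "associative_law (comm_law e1 (t *\<^sub>R e2) 0)" "associative_law (comm_law e1 (t *\<^sub>R e1) e2)"
  "associative_law (comm_law (t *\<^sub>R e1) (t *\<^sub>R e2) 0)"
  "associative_law (comm_law e2 (t\<^sup>2 *\<^sub>R e2) (t\<^sup>2 *\<^sub>R e1))"
  by (simp_all add: associative_law_def psi0_def psi5_def comm_law_def axis_def vec_eq_iff forall_2
      power2_eq_square algebra_simps)

lemma not_associative_psi4: "\<not> associative_law psi4"
proof
  assume "associative_law psi4"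
  \<comment> \<open>The idempotent \<open>e1\<close> acts on \<open>e2\<close> by 1/2, so the two
    sides are 1/2 and 1/4.\<close>
  then have "psi4 (psi4 e1 e1) e2 $ 2 = psi4 e1 (psi4 e1 e2) $ 2"
    by (simp add: associative_law_def)
  then show False
    by (simp add: psi4_def comm_law_def axis_def)
qed

lemma psi4_jordan: "psi4 \<in> jordan_laws"
  unfolding jordan_laws_def psi4_def
  by (simp add: comm_law_bilinear comm_law_commute)
    (simp add: comm_law_def axis_def vec_eq_iff forall_2 algebra_simps)

lemma trace_disc_values:
  "trace_disc psi0 = 4" "trace_disc psi5 = - 4" "trace_disc psi4 = 0"
  "trace_disc (comm_law e1 (t *\<^sub>R e2) 0) = t\<^sup>2"
  "trace_disc (comm_law e1 (t *\<^sub>R e1) e2) = 4 * t"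
  "trace_disc (comm_law (t *\<^sub>R e1) (t *\<^sub>R e2) 0) = t ^ 4"
  "trace_disc (comm_law e2 (t\<^sup>2 *\<^sub>R e2) (t\<^sup>2 *\<^sub>R e1)) = 4 * t ^ 6"
  by (simp_all add: trace_disc_def law_trace_def sum_2 psi0_def psi4_def psi5_def comm_law_def axis_def
      power_def)

lemma not_rigid_degenerate:
  "\<not> rigid (comm_law e1 0 0)" "\<not> rigid (comm_law e1 0 e2)"
  "\<not> rigid (comm_law 0 0 0)" "\<not> rigid (comm_law e2 0 0)"
proof -
  show "\<not> rigid (comm_law e1 0 0)"
    using not_rigid_if_deformation[of "\<lambda>t. e1" "\<lambda>t. t *\<^sub>R e2" "\<lambda>t. 0"]
    by (simp add: associative_comm_law_jordan associative_degenerations trace_disc_values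
        trace_disc_values(4)[of 0, simplified] continuous_intros)
  show "\<not> rigid (comm_law e1 0 e2)"
    using not_rigid_if_deformation[of "\<lambda>t. e1" "\<lambda>t. t *\<^sub>R e1" "\<lambda>t. e2"]
    by (simp add: associative_comm_law_jordan associative_degenerations trace_disc_values
        trace_disc_values(5)[of 0, simplified] continuous_intros)
  show "\<not> rigid (comm_law 0 0 0)"
    using not_rigid_if_deformation[of "\<lambda>t. t *\<^sub>R e1" "\<lambda>t. t *\<^sub>R e2" "\<lambda>t. 0"]
    by (simp add: associative_comm_law_jordan associative_degenerations trace_disc_values
        trace_disc_values(6)[of 0, simplified] continuous_intros)
  show "\<not> rigid (comm_law e2 0 0)"
    using not_rigid_if_deformation[of "\<lambda>t. e2" "\<lambda>t. t\<^sup>2 *\<^sub>R e2" "\<lambda>t. t\<^sup>2 *\<^sub>R e1"]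
    by (simp add: associative_comm_law_jordan associative_degenerations trace_disc_values
        trace_disc_values(7)[of 0, simplified] continuous_intros)
qed

text \<open>The sign of the discriminant and associativity are isomorphism invariants, and they
  separate \<open>psi0\<close>, \<open>psi5\<close> and \<open>psi4\<close> from each other and from
  the four degenerate laws, which are associative of discriminant zero.\<close>

lemma plane_orbits:
  assumes J: "\<phi> \<in> jordan_laws"
  shows "isomorphic_laws \<phi> psi0 \<longleftrightarrow> trace_disc \<phi> > 0"
    and "isomorphic_laws \<phi> psi5 \<longleftrightarrow> trace_disc \<phi> < 0"
    and "isomorphic_laws \<phi> psi4 \<longleftrightarrow> \<not> associative_law \<phi>"
proof -
  have disc: "sgn (trace_disc \<phi>) = sgn (trace_disc (comm_law a b c))"
    if "isomorphic_laws \<phi> (comm_law a b c)" for a b c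
    by (rule trace_disc_isomorphic[OF that J]) (simp add: sgn_mult, simp add: sgn_if)
  have psi: "isomorphic_laws \<phi> psi0 \<Longrightarrow> trace_disc \<phi> > 0 \<and> associative_law \<phi>"
    "isomorphic_laws \<phi> psi5 \<Longrightarrow> trace_disc \<phi> < 0 \<and> associative_law \<phi>"
    "isomorphic_laws \<phi> psi4 \<Longrightarrow> trace_disc \<phi> = 0 \<and> \<not> associative_law \<phi>"
    using disc[of e1 e1 e2, folded psi0_def] disc[of e1 "- e1" e2, folded psi5_def]
      disc[of e1 0 "(1 / 2) *\<^sub>R e2", folded psi4_def] associative_degenerations(1,2)
      not_associative_psi4 isomorphic_laws_associative isomorphic_laws_sym
    by (auto simp: trace_disc_values sgn_1_pos sgn_1_neg sgn_0_0 dest: isomorphic_laws_associative)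
  have degenerate: "trace_disc \<phi> = 0 \<and> associative_law \<phi>"
    if N: "N \<in> {comm_law e1 0 0, comm_law e1 0 e2, comm_law 0 0 0, comm_law e2 0 0}"
      and iso: "isomorphic_laws \<phi> N" for N
  proof -
    have "associative_law N" "trace_disc N = 0"
      using N associative_degenerations(3-6)[of 0] trace_disc_values(4-7)[of 0] by auto
    moreover obtain a b c where "N = comm_law a b c"
      using N by blast
    ultimately show ?thesis
      using disc[of a b c] iso isomorphic_laws_associative[OF iso] by (auto simp: sgn_0_0)
  qed
  obtain N where "N \<in> {psi0, psi4, psi5, comm_law e1 0 0, comm_law e1 0 e2, comm_law 0 0 0, comm_law e2 0 0}"
    and iso: "isomorphic_laws \<phi> N"
    using jordan_plane_cases[OF J] by blast
  then consider "isomorphic_laws \<phi> psi0" | "isomorphic_laws \<phi> psi5" | "isomorphic_laws \<phi> psi4"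
    | "trace_disc \<phi> = 0" "associative_law \<phi>"
    using degenerate[OF _ iso] by auto
  note cases = this
  show "isomorphic_laws \<phi> psi0 \<longleftrightarrow> trace_disc \<phi> > 0"
    using psi by (cases rule: cases) auto
  show "isomorphic_laws \<phi> psi5 \<longleftrightarrow> trace_disc \<phi> < 0"
    using psi by (cases rule: cases) auto
  show "isomorphic_laws \<phi> psi4 \<longleftrightarrow> \<not> associative_law \<phi>"
    using psi by (cases rule: cases) auto
qed

theorem proposition6:
  shows "rigid psi0 \<and> rigid psi4 \<and> rigid psi5 \<and>
    (\<forall>\<phi> :: 2 law. rigid \<phi> \<longrightarrow>
       isomorphic_laws \<phi> psi0 \<or> isomorphic_laws \<phi> psi4 \<or> isomorphic_laws \<phi> psi5)"
proof (intro conjI allI impI)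
  have J: "psi0 \<in> jordan_laws" "psi5 \<in> jordan_laws"
    using associative_degenerations(1,2) associative_comm_law_jordan by (simp_all add: psi0_def psi5_def)
  \<comment> \<open>The Jordan property passes along isomorphisms, so an orbit stays inside
    \<open>jordan_laws\<close> and a criterion valid there describes all of it.\<close>
  have orbit_eq: "orbit \<psi> = {\<phi> \<in> jordan_laws. P \<phi>}"
    if "\<psi> \<in> jordan_laws" "\<And>\<phi>. \<phi> \<in> jordan_laws \<Longrightarrow> isomorphic_laws \<phi> \<psi> \<longleftrightarrow> P \<phi>"
    for \<psi> :: "2 law" and P
    unfolding set_eq_iff mem_orbit_iff mem_Collect_eq
    using that isomorphic_laws_jordan[OF isomorphic_laws_sym] by metis
  show "rigid psi0"
    using J(1) openin_trace_disc[OF open_greaterThan, of 0] orbit_eq[OF J(1) plane_orbits(1)]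
    by (simp add: rigid_def)
  show "rigid psi4"
    using psi4_jordan openin_nonassociative orbit_eq[OF psi4_jordan plane_orbits(3)]
    by (simp add: rigid_def)
  show "rigid psi5"
    using J(2) openin_trace_disc[OF open_lessThan, of 0] orbit_eq[OF J(2) plane_orbits(2)]
    by (simp add: rigid_def)
  fix \<phi> :: "2 law"
  assume rigid: "rigid \<phi>"
  then obtain N where "N \<in> {psi0, psi4, psi5, comm_law e1 0 0, comm_law e1 0 e2, comm_law 0 0 0, comm_law e2 0 0}"
    and iso: "isomorphic_laws \<phi> N"
    using jordan_plane_cases by (auto simp: rigid_def)
  moreover have "rigid N"
    using rigid_isomorphic_laws[OF iso rigid] .
  ultimately show "isomorphic_laws \<phi> psi0 \<or> isomorphic_laws \<phi> psi4 \<or> isomorphic_laws \<phi> psi5"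
    using not_rigid_degenerate iso by auto
qed

end
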